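(* Let $L>0$, let $f\colon\mathbb{R}^n\to\mathbb{R}$ be convex and $L$-smooth, let $g\colon\mathbb{R}^n\to\mathbb{R}\cup\{\infty\}$ be closed, convex, and proper, let $F=f+g$ and $F_\star=\inf_{x\in\mathbb{R}^n}F(x)$. Let $K\ge 1$ be an integer and $x_0\in\mathbb{R}^n$. Define $\varphi_{K+1}=0$, $\varphi_K=1$, and, for $k=K-1,K-2,\dots,0,-1$, $$\varphi_{k}=\frac{\varphi_{k+2}^2-\varphi_{k+1}\varphi_{k+2}+2\varphi_{k+1}^2+(\varphi_{k+1}-\varphi_{k+2})\sqrt{\varphi_{k+2}^2+3\varphi_{k+1}^2}}{\varphi_{k+1}+\varphi_{k+2}}.$$ Let $x_1,\dots,x_K$ be generated by FISTA-G, that is, with $x_{-1}^{\oplus}:=x_0$, $$x_{k+1}=x_k^{\oplus}+\frac{\varphi_{k+1}-\varphi_{k+2}}{\varphi_k-\varphi_{k+1}}\left(x_k^{\oplus}-x_{k-1}^{\oplus}\right),\qquad k=0,1,\dots,K-1.$$ Then $$\min\|\partial F(x_K^{\oplus})\|^2\le 4\|\tilde\nabla_L F(x_K)\|^2\le\frac{264L}{(K+2)^2}\left(F(x_0)-F_\star\right).$$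
   Context: $\|\cdot\|$ is the Euclidean norm. $f$ is $L$-smooth if it is differentiable and $\|\nabla f(x)-\nabla f(y)\|\le L\|x-y\|$ for all $x,y\in\mathbb{R}^n$. The prox-grad step is $$x^{\oplus}=\operatorname*{arg\,min}_{y\in\mathbb{R}^n}\left\{f(x)+\langle\nabla f(x),y-x\rangle+g(y)+\frac L2\|y-x\|^2\right\},$$ and $x_k^{\oplus}=(x_k)^{\oplus}$ for $k\ge 0$. The gradient mapping is $\tilde\nabla_L F(x):=-L(x^{\oplus}-x)$. $\partial F(x)=\{u: F(x)+\langle u,y-x\rangle\le F(y)\ \forall y\in\mathbb{R}^n\}$ is the subdifferential and $\min\|\partial F(x)\|^2=\min\{\|u\|^2\mid u\in\partial F(x)\}$. *)

theory Defs
  imports "HOL-Analysis.Analysis"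
begin

definition gradient :: "('a::real_inner \<Rightarrow> real) \<Rightarrow> 'a \<Rightarrow> 'a" where
  "gradient f x = (THE d. GDERIV f x :> d)"

definition L_smooth :: "real \<Rightarrow> ('a::real_inner \<Rightarrow> real) \<Rightarrow> bool" where
  "L_smooth L f \<longleftrightarrow>
     (\<forall>x. f differentiable (at x)) \<and>
     (\<forall>x y. norm (gradient f x - gradient f y) \<le> L * norm (x - y))"

(* Extended-real-valued functions are handled through the epigraph in 'a \<times> real:
   convex means convex epigraph, closed means closed epigraph (lower semicontinuous). *)

definition ext_epigraph :: "('a \<Rightarrow> ereal) \<Rightarrow> ('a \<times> real) set" where
  "ext_epigraph g = {(x, r). g x \<le> ereal r}"

definition ext_convex :: "('a::real_vector \<Rightarrow> ereal) \<Rightarrow> bool" where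
  "ext_convex g \<longleftrightarrow> convex (ext_epigraph g)"

definition ext_closed :: "('a::topological_space \<Rightarrow> ereal) \<Rightarrow> bool" where
  "ext_closed g \<longleftrightarrow> closed (ext_epigraph g)"

(* The first conjunct also cuts the type ereal down to the codomain \<real> \<union> {\<infinity>}. *)
definition ext_proper :: "('a \<Rightarrow> ereal) \<Rightarrow> bool" where
  "ext_proper g \<longleftrightarrow> (\<forall>x. g x \<noteq> -\<infinity>) \<and> (\<exists>x. g x \<noteq> \<infinity>)"

definition subdifferential :: "('a::real_inner \<Rightarrow> ereal) \<Rightarrow> 'a \<Rightarrow> 'a set" where
  "subdifferential F x = {u. \<forall>y. F x + ereal (u \<bullet> (y - x)) \<le> F y}"

definition prox_grad ::
    "real \<Rightarrow> ('a::real_inner \<Rightarrow> real) \<Rightarrow> ('a \<Rightarrow> ereal) \<Rightarrow> 'a \<Rightarrow> 'a" where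
  "prox_grad L f g x =
     arg_min (\<lambda>y. ereal (f x + gradient f x \<bullet> (y - x)) + g y
                    + ereal (L / 2 * (norm (y - x))\<^sup>2)) (\<lambda>y. True)"

definition gradient_mapping ::
    "real \<Rightarrow> ('a::real_inner \<Rightarrow> real) \<Rightarrow> ('a \<Rightarrow> ereal) \<Rightarrow> 'a \<Rightarrow> 'a" where
  "gradient_mapping L f g x = - (L *\<^sub>R (prox_grad L f g x - x))"

end

(* Write y_k for the prox-grad step from x_k, y_(-1) = x_0, d_k = phi_k - phi_(k+1),
   e_k = (y_k - y_(k-1)) / d_k, e_(-1) = 0 and a_k = (phi_k + phi_(k+1)) / d_k^2.  The momentum
   step says x_k = y_(k-1) + d_k e_(k-1), and the recurrence for phi says a_(k+1) = a_k + 1 / d_k.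
   Adding a_k times the prox-grad inequality between y_(k-1) and x_k to 1 / d_k times the one
   between y_K and x_k gives, by downward induction on k,
     a_k (F(y_(k-1)) - F(y_K)) >= L/2 |x_K - y_K|^2 + L <y_K - y_(k-1) - phi_k e_(k-1), e_(k-1)>.
   At k = 0 this bounds |x_K - y_K|^2 by (2 a_0 / L) (F(x_0) - F(y_K)), so a_0 <= 33 / (K+2)^2
   remains.  With q_k = d_k / phi_k the sequences satisfy a_k = a_(k+1) (1 - q_k / 2) and
   q_k^2 (1 - q_(k+1) / 2) = q_(k+1)^2 (1 - q_k); these make a_k (1 + q_k) / q_k^2 nonincreasing as
   k decreases from K - 1, hence at most 33/16, and then 1 / sqrt a_k grows by at least
   1 / sqrt 33 in each step. *)
theory Submission
  imports Defs
begin

section \<open>Gradients, the tangent inequality and the descent lemma\<close>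

text \<open>\<open>gradient\<close> is a definite description, so existence and uniqueness come
  first: the adjoint of the derivative, applied to 1, is the Riesz vector that represents
  it.\<close>

lemma has_gradient:
  fixes f :: "'a::euclidean_space \<Rightarrow> real"
  assumes "f differentiable (at x)"
  shows "GDERIV f x :> gradient f x"
proof -
  obtain f' where f': "(f has_derivative f') (at x)"
    using assms by (auto simp: differentiable_def)
  then have "bounded_linear f'" by (rule has_derivative_bounded_linear)
  then have "f' h = h \<bullet> adjoint f' 1" for h
    using adjoint_works[OF bounded_linear.linear, of f' h 1] by simp
  then have "f' = (\<lambda>h. h \<bullet> adjoint f' 1)" by (rule ext)
  with f' have "GDERIV f x :> adjoint f' 1" by (simp add: gderiv_def)
  moreover have "d = adjoint f' 1" if "GDERIV f x :> d" for d
  proof -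
    have "(\<lambda>h. h \<bullet> d) = (\<lambda>h. h \<bullet> adjoint f' 1)"
      using that calculation unfolding gderiv_def by (rule has_derivative_unique)
    then have "\<forall>h. h \<bullet> d = h \<bullet> adjoint f' 1" by meson
    then show ?thesis by (simp only: vector_eq_ldot)
  qed
  ultimately show ?thesis
    unfolding gradient_def by (rule theI)
qed

lemma has_real_derivative_along_line:
  fixes f :: "'a::euclidean_space \<Rightarrow> real"
  assumes "\<And>x. f differentiable (at x)"
  shows "((\<lambda>t. f (x + t *\<^sub>R d)) has_real_derivative gradient f (x + t *\<^sub>R d) \<bullet> d) (at t)"
proof -
  have "(f has_derivative (\<lambda>h. h \<bullet> gradient f (x + t *\<^sub>R d))) (at (x + t *\<^sub>R d))"
    using has_gradient[OF assms] by (simp add: gderiv_def)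
  moreover have "((\<lambda>t. x + t *\<^sub>R d) has_derivative (\<lambda>h. h *\<^sub>R d)) (at t)"
    by (auto intro!: derivative_eq_intros)
  ultimately have "((\<lambda>t. f (x + t *\<^sub>R d)) has_derivative
      (\<lambda>h. (h *\<^sub>R d) \<bullet> gradient f (x + t *\<^sub>R d))) (at t)"
    by (rule has_derivative_compose[rotated])
  then show ?thesis
    by (rule has_derivative_imp_has_field_derivative) (simp add: inner_commute)
qed

text \<open>Restricting \<open>f\<close> to the line through \<open>x\<close> and \<open>y\<close>
  reduces this to the one-variable tangent bound between 0 and 1.\<close>

lemma convex_gradient_inequality:
  fixes f :: "'a::euclidean_space \<Rightarrow> real"
  assumes "convex_on UNIV f" and diff: "\<And>x. f differentiable (at x)"
  shows "f x + gradient f x \<bullet> (y - x) \<le> f y"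
proof -
  let ?h = "\<lambda>t. f (x + t *\<^sub>R (y - x))"
  have "convex_on UNIV ?h"
  proof (rule convex_onI)
    fix t a b :: real assume t: "0 < t" "t < 1"
    have "x + ((1 - t) *\<^sub>R a + t *\<^sub>R b) *\<^sub>R (y - x)
        = (1 - t) *\<^sub>R (x + a *\<^sub>R (y - x)) + t *\<^sub>R (x + b *\<^sub>R (y - x))"
      by (simp add: algebra_simps)
    then show "?h ((1 - t) *\<^sub>R a + t *\<^sub>R b) \<le> (1 - t) * ?h a + t * ?h b"
      using convex_onD[OF assms(1), of t] t by simp
  qed simp
  moreover have "(?h has_real_derivative gradient f x \<bullet> (y - x)) (at 0 within UNIV)"
    using has_real_derivative_along_line[OF diff, where t = 0 and x = x and d = "y - x"] by simp
  ultimately have "(gradient f x \<bullet> (y - x)) * (1 - 0) \<le> ?h 1 - ?h 0"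
    by (intro convex_on_imp_above_tangent) auto
  then show ?thesis by simp
qed

text \<open>Along the segment, \<open>f\<close> minus its linear and quadratic terms is the function
  \<open>?h\<close>, whose derivative is nonpositive on [0, 1] by the Lipschitz bound and
  Cauchy-Schwarz.\<close>

lemma descent_lemma:
  fixes f :: "'a::euclidean_space \<Rightarrow> real"
  assumes "L_smooth L f"
  shows "f y \<le> f x + gradient f x \<bullet> (y - x) + L / 2 * (norm (y - x))\<^sup>2"
proof -
  define d where "d = y - x"
  let ?h = "\<lambda>t. f (x + t *\<^sub>R d) - t * (gradient f x \<bullet> d) - L / 2 * t\<^sup>2 * (norm d)\<^sup>2"
  have diff: "f differentiable (at z)" for z
    using assms by (simp add: L_smooth_def)
  have "?h 1 \<le> ?h 0"
  proof (rule DERIV_nonpos_imp_nonincreasing[of 0 1 ?h])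
    fix t :: real assume t: "0 \<le> t" "t \<le> 1"
    let ?D = "gradient f (x + t *\<^sub>R d) \<bullet> d - gradient f x \<bullet> d - L * t * (norm d)\<^sup>2"
    have "(gradient f (x + t *\<^sub>R d) - gradient f x) \<bullet> d \<le> L * (t * norm d) * norm d"
    proof -
      have "norm (gradient f (x + t *\<^sub>R d) - gradient f x) \<le> L * norm ((x + t *\<^sub>R d) - x)"
        using assms unfolding L_smooth_def by blast
      then have "norm (gradient f (x + t *\<^sub>R d) - gradient f x) \<le> L * (t * norm d)"
        using t by simp
      then show ?thesis
        by (meson mult_right_mono norm_cauchy_schwarz norm_ge_zero order_trans)
    qed
    then have "?D \<le> 0"
      by (simp add: inner_diff_left power2_eq_square)
    moreover have "(?h has_real_derivative ?D) (at t)"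
      by (auto intro!: derivative_eq_intros has_real_derivative_along_line[OF diff])
    ultimately show "\<exists>D. (?h has_real_derivative D) (at t) \<and> D \<le> 0" by blast
  qed simp
  then show ?thesis by (simp add: d_def)
qed

section \<open>Closed convex functions and existence of the prox-grad step\<close>

lemma ext_convexD:
  assumes "ext_convex g" "g x \<le> ereal r" "g y \<le> ereal s" "0 \<le> t" "t \<le> 1"
  shows "g ((1 - t) *\<^sub>R x + t *\<^sub>R y) \<le> ereal ((1 - t) * r + t * s)"
proof -
  have "(1 - t) *\<^sub>R (x, r) + t *\<^sub>R (y, s) \<in> ext_epigraph g"
    using assms convexD_alt[of "ext_epigraph g" "(x, r)" "(y, s)" t]
    by (simp add: ext_convex_def ext_epigraph_def)
  then show ?thesis by (simp add: ext_epigraph_def)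
qed

text \<open>A point one unit below the graph is strictly separated from the closed convex epigraph.
  Comparison with the graph point above it makes the vertical component \<open>s\<close> of the
  normal positive, so the hyperplane is the graph of an affine function.\<close>

lemma ext_affine_minorant:
  fixes g :: "'a::euclidean_space \<Rightarrow> ereal"
  assumes "ext_closed g" "ext_convex g" "ext_proper g"
  obtains a c where "\<And>y. ereal (a \<bullet> y + c) \<le> g y"
proof -
  obtain z r where r: "g z = ereal r"
    using assms(3) unfolding ext_proper_def by (metis ereal_cases)
  obtain n b where nb: "n \<bullet> (z, r - 1) < b" "\<forall>w\<in>ext_epigraph g. n \<bullet> w > b"
    using separating_hyperplane_closed_point[of "ext_epigraph g" "(z, r - 1)"] assms r
    by (auto simp: ext_closed_def ext_convex_def ext_epigraph_def)
  obtain a s where n: "n = (a, s)" by fastforce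
  have above: "b < a \<bullet> y + s * t" if "g y \<le> ereal t" for y t
    using nb(2) that by (auto simp: n ext_epigraph_def)
  have "b < a \<bullet> z + s * r" using above r by simp
  with nb(1) have s: "s > 0" by (simp add: n algebra_simps)
  have "ereal ((- (1 / s) *\<^sub>R a) \<bullet> y + b / s) \<le> g y" for y
  proof (cases "g y")
    case (real t)
    then have "b < a \<bullet> y + s * t" using above by simp
    then show ?thesis using s by (simp add: real field_simps)
  next
    case MInf
    then show ?thesis using assms(3) by (simp add: ext_proper_def)
  qed simp
  then show ?thesis using that by blast
qed

text \<open>Minimising over pairs in the epigraph turns the objective into the continuous function
  \<open>?H\<close>, so one compact sublevel set suffices. It is closed because the epigraph is, and
  bounded because the quadratic term dominates the affine minorant of \<open>g\<close>.\<close>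

lemma prox_exists:
  fixes g :: "'a::euclidean_space \<Rightarrow> ereal"
  assumes g: "ext_closed g" "ext_convex g" "ext_proper g" and "L > 0"
  shows "\<exists>p. is_arg_min (\<lambda>y. ereal (c + v \<bullet> (y - x)) + g y + ereal (L / 2 * (norm (y - x))\<^sup>2))
               (\<lambda>y. True) p"
proof -
  obtain a b where ab: "\<And>y. ereal (a \<bullet> y + b) \<le> g y"
    using ext_affine_minorant[OF g] by metis
  obtain z r where r: "g z = ereal r"
    using g(3) unfolding ext_proper_def by (metis ereal_cases)
  let ?h = "\<lambda>y. c + v \<bullet> (y - x) + L / 2 * (norm (y - x))\<^sup>2"
  let ?H = "\<lambda>w. ?h (fst w) + snd w"
  define M where "M = ?h z + r"
  define S where "S = {w \<in> ext_epigraph g. ?H w \<le> M}"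
  have contH: "continuous_on A ?H" for A
    by (intro continuous_intros)
  have "closed S"
  proof -
    have "S = ext_epigraph g \<inter> {w. ?H w \<le> M}" by (auto simp: S_def)
    moreover have "closed {w. ?H w \<le> M}"
      by (intro closed_Collect_le contH continuous_on_const)
    ultimately show ?thesis using g(1) by (auto simp: ext_closed_def)
  qed
  moreover have "bounded S"
  proof -
    \<comment> \<open>With \<open>g\<close> replaced by its minorant, the objective is a quadratic
      whose linear part has slope \<open>v + a\<close>. Completing the square gives the centre
      \<open>w0\<close> and the squared radius \<open>R\<close>.\<close>
    define w0 where "w0 = x - (1 / L) *\<^sub>R (v + a)"
    define R where "R = 2 / L * (M - c - a \<bullet> x - b + (norm (v + a))\<^sup>2 / (2 * L))"
    have sq: "(norm (y - w0))\<^sup>2 \<le> R" if "(y, t) \<in> S" for y t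
    proof -
      have "a \<bullet> y + b \<le> t"
        using that ab[of y] unfolding S_def ext_epigraph_def
        by (metis (no_types, lifting) case_prodD ereal_less_eq(3) mem_Collect_eq order_trans)
      moreover have "?h y + t \<le> M" using that by (simp add: S_def)
      moreover have "(v + a) \<bullet> (y - x) = v \<bullet> (y - x) + a \<bullet> y - a \<bullet> x"
        by (simp add: inner_add_left inner_diff_right)
      ultimately have "L / 2 * (norm (y - x))\<^sup>2 + (v + a) \<bullet> (y - x) \<le> M - c - a \<bullet> x - b"
        by linarith
      then have "2 / L * (L / 2 * (norm (y - x))\<^sup>2 + (v + a) \<bullet> (y - x))
          \<le> 2 / L * (M - c - a \<bullet> x - b)"
        using \<open>L > 0\<close> by (intro mult_left_mono) auto
      moreover have "(norm (y - w0))\<^sup>2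
          = 2 / L * (L / 2 * (norm (y - x))\<^sup>2 + (v + a) \<bullet> (y - x)) + (norm (v + a))\<^sup>2 / L\<^sup>2"
      proof -
        have "y - w0 = (y - x) + (1 / L) *\<^sub>R (v + a)" by (simp add: w0_def)
        then have "(norm (y - w0))\<^sup>2
            = (norm (y - x))\<^sup>2 + 2 * ((y - x) \<bullet> ((1 / L) *\<^sub>R (v + a))) + (norm ((1 / L) *\<^sub>R (v + a)))\<^sup>2"
          by (simp only: power2_norm_eq_inner inner_add_left[of "y - x"] inner_add_right[of _ "y - x"]
              inner_commute[of "(1 / L) *\<^sub>R (v + a)" "y - x"])
        then show ?thesis
          using \<open>L > 0\<close> by (simp add: inner_commute[of "y - x"] power_divide ring_distribs)
      qed
      moreover have "R = 2 / L * (M - c - a \<bullet> x - b) + (norm (v + a))\<^sup>2 / L\<^sup>2"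
        by (simp add: R_def power2_eq_square ring_distribs)
      ultimately show ?thesis by linarith
    qed
    have y_bd: "norm y \<le> sqrt R + norm w0" if "(y, t) \<in> S" for y t
    proof -
      have "norm (y - w0) \<le> sqrt R"
        using sq[OF that] real_le_rsqrt by blast
      then show ?thesis using norm_triangle_sub[of y w0] by linarith
    qed
    define B where "B = sqrt R + norm w0"
    \<comment> \<open>The height \<open>t\<close> is bounded below by the minorant and above by the
      level \<open>M\<close>.\<close>
    have "norm w \<le> B + (\<bar>b\<bar> + norm a * B + \<bar>M - c\<bar> + norm v * (B + norm x))" if "w \<in> S" for w
    proof -
      obtain y t where w: "w = (y, t)" by fastforce
      have yB: "norm y \<le> B" using y_bd that by (simp add: w B_def)
      have "a \<bullet> y + b \<le> t"
        using that ab[of y] unfolding S_def ext_epigraph_def w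
        by (metis (no_types, lifting) case_prodD ereal_less_eq(3) mem_Collect_eq order_trans)
      moreover have "- (norm a * B) \<le> a \<bullet> y"
      proof -
        have "\<bar>a \<bullet> y\<bar> \<le> norm a * norm y" by (rule Cauchy_Schwarz_ineq2)
        also have "\<dots> \<le> norm a * B" using yB by (simp add: mult_left_mono)
        finally show ?thesis by linarith
      qed
      moreover have "?h y + t \<le> M" using that by (simp add: S_def w)
      moreover have "L / 2 * (norm (y - x))\<^sup>2 \<ge> 0" using \<open>L > 0\<close> by simp
      moreover have "- (norm v * (B + norm x)) \<le> v \<bullet> (y - x)"
      proof -
        have "\<bar>v \<bullet> (y - x)\<bar> \<le> norm v * norm (y - x)" by (rule Cauchy_Schwarz_ineq2)
        also have "\<dots> \<le> norm v * (B + norm x)"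
          using yB norm_triangle_ineq4[of y x] by (intro mult_left_mono) auto
        finally show ?thesis by linarith
      qed
      moreover have "0 \<le> norm a * B" "0 \<le> norm v * (B + norm x)"
        using yB order_trans[OF norm_ge_zero yB] by auto
      ultimately have "\<bar>t\<bar> \<le> \<bar>b\<bar> + norm a * B + \<bar>M - c\<bar> + norm v * (B + norm x)"
        by linarith
      moreover have "norm w \<le> norm y + \<bar>t\<bar>"
        unfolding w using norm_Pair_le[of y t] by simp
      ultimately show ?thesis using yB by linarith
    qed
    then show ?thesis by (rule boundedI)
  qed
  ultimately have "compact S" by (simp add: compact_eq_bounded_closed)
  moreover have "(z, r) \<in> S" by (simp add: S_def M_def ext_epigraph_def r)
  ultimately obtain w where w: "w \<in> S" "\<And>w'. w' \<in> S \<Longrightarrow> ?H w \<le> ?H w'"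
    using continuous_attains_inf[of S ?H] contH by blast
  obtain p t where pt: "w = (p, t)" by fastforce
  \<comment> \<open>\<open>M\<close> is the value at the finite point \<open>z\<close>, so epigraph
    points outside \<open>S\<close> are worse than \<open>w\<close>.\<close>
  have min: "?h p + t \<le> ?h y + s" if "g y \<le> ereal s" for y s
  proof (cases "?h y + s \<le> M")
    case True
    then have "(y, s) \<in> S" using that by (simp add: S_def ext_epigraph_def)
    then show ?thesis using w(2) pt by force
  next
    case False
    then show ?thesis using w(1) pt by (simp add: S_def)
  qed
  have "ereal (c + v \<bullet> (p - x)) + g p + ereal (L / 2 * (norm (p - x))\<^sup>2)
      \<le> ereal (c + v \<bullet> (y - x)) + g y + ereal (L / 2 * (norm (y - x))\<^sup>2)" for y
  proof -
    have gp: "g p \<le> ereal t" using w(1) pt by (simp add: S_def ext_epigraph_def)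
    show ?thesis
    proof (cases "g y")
      case (real s)
      then have "?h p + t \<le> ?h y + s" using min by simp
      then show ?thesis using gp real by (cases "g p") auto
    next
      case MInf
      then show ?thesis using g(3) by (simp add: ext_proper_def)
    qed simp
  qed
  then show ?thesis
    by (intro exI[of _ p]) (simp add: is_arg_min_linorder)
qed

section \<open>Optimality condition and prox-grad inequalities\<close>

text \<open>Move from \<open>p\<close> towards \<open>y\<close>: convexity of \<open>g\<close>
  bounds the change of the objective from above, minimality makes it nonnegative, and dividing by
  \<open>t\<close> and letting \<open>t\<close> tend to 0 removes the quadratic remainder.\<close>

lemma prox_optimality:
  fixes g :: "'a::real_inner \<Rightarrow> ereal"
  assumes min: "is_arg_min (\<lambda>y. ereal (c + v \<bullet> (y - x)) + g y + ereal (L / 2 * (norm (y - x))\<^sup>2))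
                 (\<lambda>y. True) p"
    and g: "ext_convex g" "ext_proper g"
  shows "g p \<noteq> \<infinity>" and "g p + ereal ((L *\<^sub>R (x - p) - v) \<bullet> (y - p)) \<le> g y"
proof -
  let ?h = "\<lambda>y. c + v \<bullet> (y - x) + L / 2 * (norm (y - x))\<^sup>2"
  have le: "ereal (c + v \<bullet> (p - x)) + g p + ereal (L / 2 * (norm (p - x))\<^sup>2)
      \<le> ereal (c + v \<bullet> (y - x)) + g y + ereal (L / 2 * (norm (y - x))\<^sup>2)" for y
    using min by (simp add: is_arg_min_linorder)
  have not_MInf: "g y \<noteq> -\<infinity>" for y using g(2) by (simp add: ext_proper_def)
  obtain z r where r: "g z = ereal r"
    using g(2) unfolding ext_proper_def by (metis ereal_cases)
  show fin: "g p \<noteq> \<infinity>" using le[of z] r by auto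
  then obtain gp where gp: "g p = ereal gp" using not_MInf[of p] by (cases "g p") auto
  show "g p + ereal ((L *\<^sub>R (x - p) - v) \<bullet> (y - p)) \<le> g y"
  proof (cases "g y")
    case (real gy)
    define d where "d = y - p"
    have line: "v \<bullet> d + (gy - gp) + L * ((p - x) \<bullet> d) + L / 2 * t * (norm d)\<^sup>2 \<ge> 0"
      if t: "0 < t" "t < 1" for t
    proof -
      let ?w = "(1 - t) *\<^sub>R p + t *\<^sub>R y"
      have w: "?w - x = (p - x) + t *\<^sub>R d" by (simp add: d_def algebra_simps)
      have "g ?w \<le> ereal ((1 - t) * gp + t * gy)"
        using ext_convexD[OF g(1), of p gp y gy t] gp real t by simp
      then obtain gw where gw: "g ?w = ereal gw" "gw \<le> (1 - t) * gp + t * gy"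
        using not_MInf[of ?w] by (cases "g ?w") auto
      have le: "?h p + gp \<le> ?h ?w + gw" using le[of ?w] gp gw by simp
      have n: "(norm (?w - x))\<^sup>2
          = (norm (p - x))\<^sup>2 + 2 * t * ((p - x) \<bullet> d) + t\<^sup>2 * (norm d)\<^sup>2"
        unfolding w power2_norm_eq_inner
        by (simp add: inner_add_left inner_add_right inner_commute power2_eq_square)
      have i: "v \<bullet> (?w - x) = v \<bullet> (p - x) + t * (v \<bullet> d)"
        unfolding w by (simp add: inner_add_right)
      have "gp \<le> t * (v \<bullet> d) + L / 2 * (2 * t * ((p - x) \<bullet> d) + t\<^sup>2 * (norm d)\<^sup>2)
          + ((1 - t) * gp + t * gy)"
        using le gw(2) unfolding n i by (simp add: algebra_simps)
      then have "0 \<le> t * (v \<bullet> d + (gy - gp) + L * ((p - x) \<bullet> d) + L / 2 * t * (norm d)\<^sup>2)"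
        by (simp add: field_simps power2_eq_square)
      then show ?thesis using t by (simp add: zero_le_mult_iff)
    qed
    have "((\<lambda>t. v \<bullet> d + (gy - gp) + L * ((p - x) \<bullet> d) + L / 2 * t * (norm d)\<^sup>2)
        \<longlongrightarrow> v \<bullet> d + (gy - gp) + L * ((p - x) \<bullet> d) + L / 2 * 0 * (norm d)\<^sup>2) (at_right 0)"
      by (intro tendsto_intros)
    then have "v \<bullet> d + (gy - gp) + L * ((p - x) \<bullet> d) + L / 2 * 0 * (norm d)\<^sup>2 \<ge> 0"
    proof (rule tendsto_lowerbound)
      show "\<forall>\<^sub>F t in at_right 0. 0 \<le> v \<bullet> d + (gy - gp) + L * ((p - x) \<bullet> d) + L / 2 * t * (norm d)\<^sup>2"
        using line by (auto simp: eventually_at_right_field intro!: exI[of _ 1])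
    qed simp
    then show ?thesis
      by (simp add: gp real d_def inner_diff_left algebra_simps)
  next
    case MInf
    with not_MInf show ?thesis by blast
  qed simp
qed

lemma prox_grad_optimality:
  fixes f :: "'a::euclidean_space \<Rightarrow> real" and x :: 'a
  assumes "L > 0" "ext_closed g" "ext_convex g" "ext_proper g"
  defines "p \<equiv> prox_grad L f g x"
  shows "g p \<noteq> \<infinity>" and "g p + ereal ((L *\<^sub>R (x - p) - gradient f x) \<bullet> (y - p)) \<le> g y"
proof -
  \<comment> \<open>\<open>arg_min\<close> is a choice operator, so \<open>p\<close> is known to be
    a minimizer only through existence of one.\<close>
  have "is_arg_min (\<lambda>y. ereal (f x + gradient f x \<bullet> (y - x)) + g y + ereal (L / 2 * (norm (y - x))\<^sup>2))
      (\<lambda>y. True) p"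
    unfolding p_def prox_grad_def arg_min_def
    by (rule someI_ex) (rule prox_exists[OF assms(2-4,1)])
  from prox_optimality[OF this assms(3,4)]
  show "g p \<noteq> \<infinity>" and "g p + ereal ((L *\<^sub>R (x - p) - gradient f x) \<bullet> (y - p)) \<le> g y"
    by auto
qed

text \<open>The gradient of \<open>f\<close> at \<open>p\<close> is added to the subgradient of
  \<open>g\<close> given by optimality. Smoothness bounds the difference of the two gradients by
  \<open>L * norm (x - p)\<close>, which later yields the factor 4.\<close>

lemma prox_grad_subgradient:
  fixes f :: "'a::euclidean_space \<Rightarrow> real" and x :: 'a
  assumes "L > 0" "convex_on UNIV f" "L_smooth L f" "ext_closed g" "ext_convex g" "ext_proper g"
    and F: "\<And>y. F y = ereal (f y) + g y"
  defines "p \<equiv> prox_grad L f g x"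
  shows "gradient f p - gradient f x + L *\<^sub>R (x - p) \<in> subdifferential F p"
  unfolding subdifferential_def
proof (intro CollectI allI)
  fix y
  have "f p + gradient f p \<bullet> (y - p) \<le> f y"
    using assms(2,3) by (intro convex_gradient_inequality) (auto simp: L_smooth_def)
  moreover have "g p + ereal ((L *\<^sub>R (x - p) - gradient f x) \<bullet> (y - p)) \<le> g y"
    unfolding p_def by (rule prox_grad_optimality(2)) (use assms in auto)
  ultimately have "ereal (f p + gradient f p \<bullet> (y - p)) +
      (g p + ereal ((L *\<^sub>R (x - p) - gradient f x) \<bullet> (y - p))) \<le> ereal (f y) + g y"
    by (intro add_mono) auto
  then show "F p + ereal ((gradient f p - gradient f x + L *\<^sub>R (x - p)) \<bullet> (y - p)) \<le> F y"
    unfolding F by (cases "g p"; cases "g y") (auto simp: inner_diff_left inner_add_left algebra_simps)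
qed

text \<open>Linearising \<open>f\<close> at \<open>x\<close>, the tangent bounds \<open>f y\<close>
  from below and the descent lemma bounds \<open>f p\<close> from above; optimality of
  \<open>p\<close> treats \<open>g\<close>. The point \<open>y\<close> stays free because the
  potential uses both the previous and the last prox-grad step there.\<close>

lemma prox_grad_inequality:
  fixes f :: "'a::euclidean_space \<Rightarrow> real" and x :: 'a
  assumes "L > 0" "convex_on UNIV f" "L_smooth L f" "ext_closed g" "ext_convex g" "ext_proper g"
    and F: "\<And>y. F y = ereal (f y) + g y"
  defines "p \<equiv> prox_grad L f g x"
  shows "F p + ereal (L * ((x - p) \<bullet> (y - x)) + L / 2 * (norm (x - p))\<^sup>2) \<le> F y"
proof -
  have "f x + gradient f x \<bullet> (y - x) \<le> f y"
    using assms(2,3) by (intro convex_gradient_inequality) (auto simp: L_smooth_def)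
  moreover have "f p \<le> f x + gradient f x \<bullet> (p - x) + L / 2 * (norm (x - p))\<^sup>2"
    using descent_lemma[OF assms(3), of p x] by (simp add: norm_minus_commute)
  ultimately have "f p + gradient f x \<bullet> (y - p) - L / 2 * (norm (x - p))\<^sup>2 \<le> f y"
    by (simp add: inner_diff_right)
  moreover have "g p + ereal ((L *\<^sub>R (x - p) - gradient f x) \<bullet> (y - p)) \<le> g y"
    unfolding p_def by (rule prox_grad_optimality(2)) (use assms in auto)
  ultimately have "ereal (f p + gradient f x \<bullet> (y - p) - L / 2 * (norm (x - p))\<^sup>2) +
      (g p + ereal ((L *\<^sub>R (x - p) - gradient f x) \<bullet> (y - p))) \<le> ereal (f y) + g y"
    by (intro add_mono) auto
  moreover have "(L *\<^sub>R (x - p) - gradient f x) \<bullet> (y - p)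
      = L * ((x - p) \<bullet> (y - x)) + L * (norm (x - p))\<^sup>2 - gradient f x \<bullet> (y - p)"
  proof -
    have "(x - p) \<bullet> (y - p) = (x - p) \<bullet> (y - x) + (x - p) \<bullet> (x - p)"
      by (simp flip: inner_add_right)
    then show ?thesis
      by (simp add: inner_diff_left[of _ "gradient f x"] power2_norm_eq_inner distrib_left)
  qed
  ultimately show ?thesis
    unfolding F by (cases "g p"; cases "g y") (auto simp: field_simps)
qed

text \<open>Since \<open>F p\<close> is finite, each \<open>y\<close> imposes a closed condition on
  the subgradient. A nonempty closed set has a point nearest to 0.\<close>

lemma min_norm_subgradient:
  fixes F :: "'a::euclidean_space \<Rightarrow> ereal"
  assumes "\<bar>F p\<bar> \<noteq> \<infinity>" and "u \<in> subdifferential F p"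
  obtains w where "is_arg_min (\<lambda>v. (norm v)\<^sup>2) (\<lambda>v. v \<in> subdifferential F p) w" "norm w \<le> norm u"
proof -
  obtain r where r: "F p = ereal r" using assms(1) by (cases "F p") auto
  have "closed {v. F p + ereal (v \<bullet> (y - p)) \<le> F y}" for y
  proof (cases "F y")
    case (real s)
    have "closed {v. r + v \<bullet> (y - p) \<le> s}"
      by (intro closed_Collect_le continuous_intros)
    then show ?thesis by (simp add: r real)
  qed (auto simp: r)
  then have "closed (subdifferential F p)"
    unfolding subdifferential_def by (intro closed_Collect_all)
  then obtain w where w: "w \<in> subdifferential F p"
      "\<And>v. v \<in> subdifferential F p \<Longrightarrow> dist 0 w \<le> dist 0 v"
    using distance_attains_inf[of "subdifferential F p" 0] assms(2) by blast
  then have "is_arg_min (\<lambda>v. (norm v)\<^sup>2) (\<lambda>v. v \<in> subdifferential F p) w"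
    by (auto simp: is_arg_min_linorder)
  then show ?thesis using w assms(2) that by simp
qed

section \<open>Decay rate of the weights\<close>

text \<open>The index runs backwards from the last iteration: \<open>A j\<close> and
  \<open>q j\<close> stand for the weight a_(K-j) and the ratio q_(K-j).\<close>

lemma fista_g_rate:
  fixes A q :: "nat \<Rightarrow> real"
  assumes A0: "A 0 = 1" and q0: "q 0 = 1"
    and q: "\<And>j. j \<le> n \<Longrightarrow> 0 < q j \<and> q j \<le> 1"
    and A: "\<And>j. j < n \<Longrightarrow> A (Suc j) = A j * (1 - q (Suc j) / 2)"
    and rec: "\<And>j. j < n \<Longrightarrow> (q (Suc j))\<^sup>2 * (1 - q j / 2) = (q j)\<^sup>2 * (1 - q (Suc j))"
  shows "A n \<le> 33 / (real n + 2)\<^sup>2"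
proof -
  have Apos: "0 < A j" if "j \<le> n" for j
    using that
  proof (induction j)
    case (Suc j)
    then have "0 < A j * (1 - q (Suc j) / 2)"
      using q[of "Suc j"] by (intro mult_pos_pos) auto
    with A Suc show ?case by simp
  qed (simp add: A0)
  have q1: "(q 1)\<^sup>2 = 2 - 2 * q 1" if "1 \<le> n"
    using rec[of 0] that by (simp add: q0)
  \<comment> \<open>The exact value is sqrt 3 - 1, about 0.73205. The base case of
    \<open>inv\<close> needs \<open>q 1\<close> to be at most 11/15.\<close>
  have q1_less: "q 1 \<le> 733 / 1000" if "1 \<le> n"
  proof (rule ccontr)
    assume "\<not> q 1 \<le> 733 / 1000"
    then have "(733 / 1000)\<^sup>2 < (q 1)\<^sup>2" by (intro power_strict_mono) auto
    with q1[OF that] \<open>\<not> q 1 \<le> 733 / 1000\<close> show False by (simp add: power2_eq_square)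
  qed
  \<comment> \<open>If \<open>q\<close> did not drop, the left side of \<open>rec\<close> would
    exceed the right, because \<open>1 - q j / 2\<close> loses only half of
    \<open>q j\<close>.\<close>
  have decr: "q (Suc j) < q j" if "j < n" for j
  proof (rule ccontr)
    assume "\<not> q (Suc j) < q j"
    then have le: "q j \<le> q (Suc j)" by simp
    have "(q j)\<^sup>2 * (1 - q (Suc j)) \<le> (q (Suc j))\<^sup>2 * (1 - q (Suc j))"
      using le q[of j] q[of "Suc j"] that by (intro mult_right_mono power_mono) auto
    also have "\<dots> < (q (Suc j))\<^sup>2 * (1 - q j / 2)"
      using le q[of j] q[of "Suc j"] that by (intro mult_strict_left_mono) auto
    finally show False using rec[OF that] by simp
  qed
  \<comment> \<open>The threshold 3/5 is where the factor \<open>3 - 5 * a\<close> in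
    \<open>R_le\<close> changes sign. \<open>q 1\<close> lies above it and \<open>q 2\<close> is
    about 0.589, hence the shift by two.\<close>
  have q_le: "q (Suc (Suc j)) \<le> 3 / 5" if "Suc j < n" for j
    using that
  proof (induction j)
    case 0
    show ?case
    proof (rule ccontr)
      assume "\<not> q (Suc (Suc 0)) \<le> 3 / 5"
      then have a: "q (Suc (Suc 0)) > 3 / 5" by simp
      have b: "q 1 \<le> 733 / 1000" "0 < q 1" using q1_less q[of 1] 0 by auto
      have "(3 / 5)\<^sup>2 * (1 - 733 / 1000 / 2) < (q (Suc (Suc 0)))\<^sup>2 * (1 - q (Suc 0) / 2)"
        using a b by (intro mult_strict_mono' mult_less_le_imp_less power_strict_mono) auto
      also have "\<dots> = (q (Suc 0))\<^sup>2 * (1 - q (Suc (Suc 0)))" using rec[of "Suc 0"] 0 by simp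
      also have "\<dots> \<le> (733 / 1000)\<^sup>2 * (1 - 3 / 5)"
        using a b q[of "Suc (Suc 0)"] 0 by (intro mult_mono power_mono) auto
      finally show False by (simp add: power2_eq_square)
    qed
  next
    case (Suc j)
    then show ?case using decr[of "Suc (Suc j)"] by simp
  qed
  \<comment> \<open>The quotient \<open>A j * (1 + q j) / (q j)\<^sup>2\<close> is 2 at
    \<open>j = 0\<close> and rises to 3 (1 + sqrt 3) / 4 < 33/16 at \<open>j = 1\<close>. Only from
    there on is it nonincreasing, so the induction starts at 1.\<close>
  have inv: "A (Suc j) * (1 + q (Suc j)) \<le> 33 / 16 * (q (Suc j))\<^sup>2" if "Suc j \<le> n" for j
    using that
  proof (induction j)
    case 0
    have "A (Suc 0) = 1 - q 1 / 2" using A[of 0] 0 by (simp add: A0)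
    then have "A (Suc 0) * (1 + q 1) = 1 + q 1 / 2 - (q 1)\<^sup>2 / 2"
      by (simp only:) (simp add: field_simps power2_eq_square)
    also have "\<dots> \<le> 33 / 16 * (q 1)\<^sup>2"
      using q1 q1_less 0 by linarith
    finally show ?case by simp
  next
    case (Suc j)
    define a where "a = q (Suc (Suc j))"
    define b where "b = q (Suc j)"
    (* The inequality key below is linear in b; R is the value of b at which it is an equality. *)
    define R where "R = 2 * a * (3 - a) / (6 - 3 * a - a\<^sup>2)"
    have a: "0 < a" "a \<le> 3 / 5" and b: "0 < b" "b \<le> 1"
      using q_le[of j] q[of "Suc j"] q[of "Suc (Suc j)"] Suc.prems by (auto simp: a_def b_def)
    have ab: "a\<^sup>2 * (1 - b / 2) = b\<^sup>2 * (1 - a)"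
      using rec[of "Suc j"] Suc.prems by (simp add: a_def b_def)
    have a2: "a\<^sup>2 \<le> 1" using a by (simp add: power_le_one)
    then have D: "6 - 3 * a - a\<^sup>2 > 0" using a by linarith
    have R: "R > 0" using a D by (simp add: R_def)
    have RD: "R * (6 - 3 * a - a\<^sup>2) = 2 * a * (3 - a)" using D by (simp add: R_def)
    \<comment> \<open>In \<open>ab\<close>, read as an equation for \<open>b\<close>, one side
      increases and the other decreases in \<open>b\<close>. This inequality therefore places
      \<open>R\<close> at or before the crossing point. Multiplied by the square of the denominator
      of \<open>R\<close>, it factors with \<open>3 - 5 * a\<close>.\<close>
    have R_le: "R\<^sup>2 * (1 - a) \<le> a\<^sup>2 * (1 - R / 2)"
    proof -
      let ?D = "6 - 3 * a - a\<^sup>2"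
      have "(a\<^sup>2 * (1 - R / 2) - R\<^sup>2 * (1 - a)) * ?D\<^sup>2
          = a\<^sup>2 * ?D\<^sup>2 - a\<^sup>2 / 2 * (R * ?D) * ?D - (R * ?D)\<^sup>2 * (1 - a)"
        by (simp add: field_simps power2_eq_square)
      also have "\<dots> = a\<^sup>2 * (2 * a * (1 - a) * (3 - 5 * a))"
        unfolding RD by (simp add: field_simps power2_eq_square)
      also have "\<dots> \<ge> 0" using a by simp
      finally show ?thesis using D by (simp add: zero_le_mult_iff)
    qed
    have "R \<le> b"
    proof (rule ccontr)
      assume "\<not> R \<le> b"
      then have "b < R" by simp
      then have "b\<^sup>2 * (1 - a) < R\<^sup>2 * (1 - a)"
        using a b by (intro mult_strict_right_mono power_strict_mono) auto
      also have "\<dots> \<le> a\<^sup>2 * (1 - R / 2)" by (rule R_le)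
      also have "\<dots> \<le> a\<^sup>2 * (1 - b / 2)"
        using \<open>b < R\<close> by (intro mult_left_mono) auto
      finally show False using ab by simp
    qed
    then have "2 * a * (3 - a) \<le> b * (6 - 3 * a - a\<^sup>2)"
      using D by (simp flip: RD)
    then have key: "(1 - b / 2) * (1 - a / 2) * (1 + a) \<le> (1 - a) * (1 + b)"
      by (simp add: field_simps power2_eq_square)
    \<comment> \<open>The target is multiplied by the positive factor
      \<open>(1 + b) * (1 - a)\<close>. The induction hypothesis brings in \<open>b\<^sup>2\<close>,
      \<open>ab\<close> trades \<open>b\<^sup>2 * (1 - a)\<close> for
      \<open>a\<^sup>2 * (1 - b / 2)\<close>, and \<open>key\<close> finishes.\<close>
    have "A (Suc (Suc j)) * (1 + a) * ((1 + b) * (1 - a))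
        = (A (Suc j) * (1 + b)) * ((1 - a / 2) * (1 + a) * (1 - a))"
      using A[of "Suc j"] Suc.prems by (simp add: a_def)
    also have "\<dots> \<le> 33 / 16 * b\<^sup>2 * ((1 - a / 2) * (1 + a) * (1 - a))"
      using Suc a by (intro mult_right_mono) (auto simp: b_def)
    also have "\<dots> = 33 / 16 * (1 - a / 2) * (1 + a) * (b\<^sup>2 * (1 - a))" by simp
    also have "\<dots> = 33 / 16 * a\<^sup>2 * ((1 - b / 2) * (1 - a / 2) * (1 + a))"
      by (simp flip: ab)
    also have "\<dots> \<le> 33 / 16 * a\<^sup>2 * ((1 - a) * (1 + b))"
      using key by (intro mult_left_mono) auto
    finally have "A (Suc (Suc j)) * (1 + a) * ((1 + b) * (1 - a))
        \<le> 33 / 16 * a\<^sup>2 * ((1 + b) * (1 - a))" by (simp add: ac_simps)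
    then have "A (Suc (Suc j)) * (1 + a) \<le> 33 / 16 * a\<^sup>2"
      by (rule mult_right_le_imp_le) (use a b in auto)
    then show ?case by (simp add: a_def)
  qed
  \<comment> \<open>Since \<open>sqrt (1 - q / 2) \<le> 1 - q / 4\<close>, one step raises
    \<open>1 / sqrt A\<close> by at least \<open>q / (4 * sqrt A)\<close>, with \<open>q\<close> and
    \<open>A\<close> at the new index. By \<open>inv\<close> this is at least
    \<open>1 / sqrt 33\<close>.\<close>
  have "(real j + 2) / sqrt 33 \<le> 1 / sqrt (A j)" if "j \<le> n" for j
    using that
  proof (induction j)
    case 0
    have "sqrt 4 \<le> sqrt 33" by (rule real_sqrt_le_mono) simp
    then show ?case by (simp add: A0)
  next
    case (Suc j)
    let ?q = "q (Suc j)" and ?A = "A (Suc j)"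
    have q': "0 < ?q" "?q \<le> 1" using q Suc.prems by auto
    have pos: "0 < ?A" "0 < A j" using Apos Suc.prems by auto
    have "?A \<le> ?A * (1 + ?q)" using pos q' by simp
    also have "\<dots> \<le> 33 / 16 * ?q\<^sup>2" using inv Suc.prems by simp
    finally have "sqrt ?A \<le> sqrt (33 / 16 * ?q\<^sup>2)" by (rule real_sqrt_le_mono)
    also have "\<dots> = sqrt 33 / 4 * ?q"
    proof -
      have "sqrt (16::real) = 4" by (rule real_sqrt_unique) auto
      then show ?thesis using q' by (simp add: real_sqrt_mult real_sqrt_divide)
    qed
    finally have sq: "sqrt ?A \<le> sqrt 33 / 4 * ?q" .
    have "1 / sqrt (A j) = sqrt (1 - ?q / 2) / sqrt ?A"
    proof -
      have "sqrt ?A = sqrt (A j) * sqrt (1 - ?q / 2)"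
        using A[of j] Suc.prems by (simp add: real_sqrt_mult)
      moreover have "sqrt (1 - ?q / 2) > 0" using q' by simp
      ultimately show ?thesis by simp
    qed
    also have "\<dots> \<le> (1 - ?q / 4) / sqrt ?A"
    proof (intro divide_right_mono real_le_lsqrt)
      show "1 - ?q / 2 \<le> (1 - ?q / 4)\<^sup>2" by (simp add: power2_eq_square field_simps)
    qed (use q' pos in auto)
    also have "\<dots> \<le> 1 / sqrt ?A - 1 / sqrt 33"
      using sq pos q' by (simp add: field_simps)
    finally show ?case using Suc by (simp add: add_divide_distrib)
  qed
  from this[of n] have "(real n + 2) * sqrt (A n) \<le> sqrt 33"
    using Apos[of n] by (simp add: field_simps)
  then have "((real n + 2) * sqrt (A n))\<^sup>2 \<le> (sqrt 33)\<^sup>2"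
    using Apos[of n] by (intro power_mono) auto
  then have "(real n + 2)\<^sup>2 * A n \<le> 33"
    unfolding power_mult_distrib using Apos[of n] by simp
  then show ?thesis by (simp add: pos_le_divide_eq mult.commute)
qed

section \<open>The recurrence for phi\<close>

text \<open>The recurrence gives the larger root \<open>p\<close> of the quadratic equation in the
  second conclusion. That equation is a_(k+1) = a_k + 1 / d_k with denominators cleared, for
  \<open>p\<close>, \<open>q\<close>, \<open>r\<close> the values of phi at k, k+1, k+2.\<close>

lemma fista_g_phi_step:
  fixes p q r :: real
  assumes "0 \<le> r" "r < q"
    and p: "p = (r\<^sup>2 - q * r + 2 * q\<^sup>2 + (q - r) * sqrt (r\<^sup>2 + 3 * q\<^sup>2)) / (q + r)"
  shows "q < p" "(q + r) * (p - q)\<^sup>2 = 2 * p * (q - r)\<^sup>2"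
proof -
  define s where "s = sqrt (r\<^sup>2 + 3 * q\<^sup>2)"
  have s: "s\<^sup>2 = r\<^sup>2 + 3 * q\<^sup>2" "s \<ge> 0" by (simp_all add: s_def)
  have pos: "q + r > 0" using assms by simp
  have "p * (q + r) = r\<^sup>2 - q * r + 2 * q\<^sup>2 + (q - r) * s"
    using pos by (simp add: p s_def)
  then have diff: "(p - q) * (q + r) = (q - r) * (q - r + s)"
    and ps: "p * (q + r) = r\<^sup>2 - q * r + 2 * q\<^sup>2 + (q - r) * s"
    by (simp_all add: algebra_simps power2_eq_square)
  have "0 < (p - q) * (q + r)" unfolding diff using assms s by simp
  then show "q < p" using pos by (simp add: zero_less_mult_iff)
  have "(q + r) * ((q + r) * (p - q)\<^sup>2) = ((p - q) * (q + r))\<^sup>2"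
    by (simp add: power2_eq_square)
  also have "\<dots> = (q - r)\<^sup>2 * ((q - r)\<^sup>2 + 2 * (q - r) * s + s\<^sup>2)"
    unfolding diff by (simp add: power2_eq_square algebra_simps)
  also have "\<dots> = 2 * (q - r)\<^sup>2 * (p * (q + r))"
    unfolding s(1) ps by (simp add: power2_eq_square algebra_simps)
  finally have "(q + r) * ((q + r) * (p - q)\<^sup>2) = (q + r) * (2 * p * (q - r)\<^sup>2)"
    by (simp add: ac_simps)
  then show "(q + r) * (p - q)\<^sup>2 = 2 * p * (q - r)\<^sup>2"
    using pos by simp
qed

text \<open>Downward induction from the values 1 and 0 at the end. Strict decrease makes every d_k
  positive, so the momentum coefficients and weights have nonzero denominators.\<close>

lemma fista_g_phi:
  fixes \<phi> :: "int \<Rightarrow> real"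
  assumes "\<phi> (K + 1) = 0" and "\<phi> K = 1"
    and rec: "\<And>k. k \<in> {0..K - 1} \<Longrightarrow>
           \<phi> k = ((\<phi> (k + 2))\<^sup>2 - \<phi> (k + 1) * \<phi> (k + 2) + 2 * (\<phi> (k + 1))\<^sup>2
                   + (\<phi> (k + 1) - \<phi> (k + 2)) * sqrt ((\<phi> (k + 2))\<^sup>2 + 3 * (\<phi> (k + 1))\<^sup>2))
                  / (\<phi> (k + 1) + \<phi> (k + 2))"
    and "0 \<le> k" "k \<le> K"
  shows "0 \<le> \<phi> (k + 1) \<and> \<phi> (k + 1) < \<phi> k"
  using \<open>k \<le> K\<close> \<open>0 \<le> k\<close>
proof (induction k rule: int_le_induct)
  case base
  then show ?case using assms(1,2) by simp
next
  case (step i)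
  then have "0 \<le> \<phi> (i + 1)" "\<phi> (i + 1) < \<phi> i" by auto
  moreover from this have "\<phi> i < \<phi> (i - 1)"
    by (rule fista_g_phi_step(1)) (use rec[of "i - 1"] step in \<open>simp add: add.commute\<close>)
  ultimately show ?case by simp
qed

section \<open>The potential argument\<close>

text \<open>One downward step of the induction: \<open>\<phi>\<close>, \<open>d\<close>,
  \<open>a\<close> are taken at k, \<open>\<phi>'\<close> and \<open>a'\<close> at k+1,
  \<open>e\<close> and \<open>v\<close> at k-1, \<open>e'\<close> and \<open>v'\<close> at k;
  \<open>u\<close> is the final value and \<open>w\<close> is y_K - y_k. The result is
  \<open>a\<close> times \<open>decr\<close> plus \<open>1 / d\<close> times \<open>last\<close>
  plus \<open>IH\<close>.\<close>

lemma fista_g_potential_step: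
  fixes \<phi> \<phi>' d a a' :: real and e e' w :: "'a::real_inner"
  assumes d: "d = \<phi> - \<phi>'" "d > 0" and a: "a * d\<^sup>2 = \<phi> + \<phi>'" "a \<ge> 0" and a': "a' = a + 1 / d"
    and decr: "L * ((d *\<^sub>R (e - e')) \<bullet> (- (d *\<^sub>R e))) + L / 2 * (norm (d *\<^sub>R (e - e')))\<^sup>2 \<le> v - v'"
    and last: "L * ((d *\<^sub>R (e - e')) \<bullet> (w + d *\<^sub>R e' - d *\<^sub>R e)) + L / 2 * (norm (d *\<^sub>R (e - e')))\<^sup>2 \<le> u - v'"
    and IH: "c + L * ((w - \<phi>' *\<^sub>R e') \<bullet> e') \<le> a' * (v' - u)"
  shows "c + L * ((w + d *\<^sub>R e' - \<phi> *\<^sub>R e) \<bullet> e) \<le> a * (v - u)"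
proof -
  let ?N = "e \<bullet> e - 2 * (e \<bullet> e') + e' \<bullet> e'"
  have N: "(norm (d *\<^sub>R (e - e')))\<^sup>2 = d\<^sup>2 * ?N"
    unfolding power2_norm_eq_inner
    by (simp add: inner_diff_left inner_diff_right inner_commute power2_eq_square algebra_simps)
  have "L * (- (\<phi> + \<phi>') * (e \<bullet> e - e \<bullet> e') + (\<phi> + \<phi>') / 2 * ?N) \<le> a * (v - v')"
  proof -
    have "a * (L * ((d *\<^sub>R (e - e')) \<bullet> (- (d *\<^sub>R e))) + L / 2 * (norm (d *\<^sub>R (e - e')))\<^sup>2) \<le> a * (v - v')"
      using decr a(2) by (rule mult_left_mono)
    also have "a * (L * ((d *\<^sub>R (e - e')) \<bullet> (- (d *\<^sub>R e))) + L / 2 * (norm (d *\<^sub>R (e - e')))\<^sup>2)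
        = L * (- (a * d\<^sup>2) * (e \<bullet> e - e \<bullet> e') + (a * d\<^sup>2) / 2 * ?N)"
      unfolding N
      by (simp add: inner_diff_left inner_diff_right inner_commute power2_eq_square field_simps)
    finally show ?thesis unfolding a(1) .
  qed
  moreover have "L * ((e \<bullet> w - e' \<bullet> w) - d / 2 * ?N) \<le> 1 / d * (u - v')"
  proof -
    have "(d *\<^sub>R (e - e')) \<bullet> (w + d *\<^sub>R e' - d *\<^sub>R e) = d * (e \<bullet> w - e' \<bullet> w) - d\<^sup>2 * ?N"
      by (simp add: inner_diff_left inner_diff_right inner_add_right inner_commute power2_eq_square algebra_simps)
    with last N have "L * (d * (e \<bullet> w - e' \<bullet> w) - d\<^sup>2 * ?N) + L / 2 * (d\<^sup>2 * ?N) \<le> u - v'"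
      by simp
    also have "L * (d * (e \<bullet> w - e' \<bullet> w) - d\<^sup>2 * ?N) + L / 2 * (d\<^sup>2 * ?N)
        = (L * ((e \<bullet> w - e' \<bullet> w) - d / 2 * ?N)) * d"
      by (simp add: field_simps power2_eq_square)
    finally show ?thesis using d(2) by (simp add: pos_le_divide_eq)
  qed
  \<comment> \<open>The choice of \<open>a'\<close> makes the coefficient of \<open>v'\<close>
    vanish.\<close>
  moreover have "a * (v - u) = a * (v - v') + 1 / d * (u - v') + a' * (v' - u)"
    by (simp add: a' algebra_simps diff_divide_distrib)
  ultimately have "L * (- (\<phi> + \<phi>') * (e \<bullet> e - e \<bullet> e') + (\<phi> + \<phi>') / 2 * ?N)
      + L * ((e \<bullet> w - e' \<bullet> w) - d / 2 * ?N) + (c + L * ((w - \<phi>' *\<^sub>R e') \<bullet> e')) \<le> a * (v - u)"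
    using IH by linarith
  \<comment> \<open>The inner products match exactly once \<open>d\<close> is replaced by
    \<open>\<phi> - \<phi>'\<close>; no slack is lost here.\<close>
  also have "L * (- (\<phi> + \<phi>') * (e \<bullet> e - e \<bullet> e') + (\<phi> + \<phi>') / 2 * ?N)
      + L * ((e \<bullet> w - e' \<bullet> w) - d / 2 * ?N) + (c + L * ((w - \<phi>' *\<^sub>R e') \<bullet> e'))
      = c + L * ((w + d *\<^sub>R e' - \<phi> *\<^sub>R e) \<bullet> e)"
  proof -
    have 1: "(w - \<phi>' *\<^sub>R e') \<bullet> e' = e' \<bullet> w - \<phi>' * (e' \<bullet> e')"
      by (simp add: inner_diff_left inner_commute[of w])
    have 2: "(w + d *\<^sub>R e' - \<phi> *\<^sub>R e) \<bullet> e = e \<bullet> w + d * (e \<bullet> e') - \<phi> * (e \<bullet> e)"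
      by (simp add: inner_diff_left inner_add_left inner_commute[of w] inner_commute[of e'])
    show ?thesis unfolding 1 2 unfolding d(1) by (simp add: field_simps)
  qed
  finally show ?thesis .
qed

text \<open>\<open>v k\<close> stands for the finite value of F at \<open>y k\<close>. Apart from
  the momentum step, the iteration enters only through the prox-grad inequalities
  \<open>ineq\<close>.\<close>

lemma fista_g_potential:
  fixes \<phi> v :: "int \<Rightarrow> real" and x y :: "int \<Rightarrow> 'a::real_inner"
  assumes K: "0 \<le> K" and last: "\<phi> (K + 1) = 0" "\<phi> K = 1"
    and pos: "\<And>k. 0 \<le> k \<Longrightarrow> k \<le> K \<Longrightarrow> 0 \<le> \<phi> (k + 1) \<and> \<phi> (k + 1) < \<phi> k"
    and rec: "\<And>k. 0 \<le> k \<Longrightarrow> k < K \<Longrightarrow>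
      (\<phi> (k + 1) + \<phi> (k + 2)) * (\<phi> k - \<phi> (k + 1))\<^sup>2 = 2 * \<phi> k * (\<phi> (k + 1) - \<phi> (k + 2))\<^sup>2"
    and y0: "y (-1) = x 0"
    and x: "\<And>k. 0 \<le> k \<Longrightarrow> k < K \<Longrightarrow>
      x (k + 1) = y k + ((\<phi> (k + 1) - \<phi> (k + 2)) / (\<phi> k - \<phi> (k + 1))) *\<^sub>R (y k - y (k - 1))"
    and ineq: "\<And>j k. 0 \<le> k \<Longrightarrow> k \<le> K \<Longrightarrow> - 1 \<le> j \<Longrightarrow> j \<le> K \<Longrightarrow>
      v k + L * ((x k - y k) \<bullet> (y j - x k)) + L / 2 * (norm (x k - y k))\<^sup>2 \<le> v j"
  shows "L / 2 * (norm (x K - y K))\<^sup>2 \<le> (\<phi> 0 + \<phi> 1) / (\<phi> 0 - \<phi> 1)\<^sup>2 * (v (-1) - v K)"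
proof -
  define d where "d k = \<phi> k - \<phi> (k + 1)" for k
  \<comment> \<open>The value 0 at negative indices lets \<open>x_eq\<close> cover
    \<open>x 0 = y (-1)\<close> and removes the inner product when the induction reaches
    \<open>k = 0\<close>.\<close>
  define e where "e k = (if k < 0 then 0 else (1 / d k) *\<^sub>R (y k - y (k - 1)))" for k
  define a where "a k = (\<phi> k + \<phi> (k + 1)) / (d k)\<^sup>2" for k
  define c where "c = L / 2 * (norm (x K - y K))\<^sup>2"
  have d: "d k > 0" if "0 \<le> k" "k \<le> K" for k
    using pos that by (simp add: d_def)
  have y_eq: "y k = y (k - 1) + d k *\<^sub>R e k" if "0 \<le> k" "k \<le> K" for k
    using d[OF that] that by (simp add: e_def)
  have x_eq: "x k = y (k - 1) + d k *\<^sub>R e (k - 1)" if "0 \<le> k" "k \<le> K" for k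
  proof (cases "k = 0")
    case True
    then show ?thesis using y0 by (simp add: e_def)
  next
    case False
    then show ?thesis
      using x[of "k - 1"] that by (simp add: e_def d_def algebra_simps)
  qed
  have g_eq: "x k - y k = d k *\<^sub>R (e (k - 1) - e k)" if "0 \<le> k" "k \<le> K" for k
    using x_eq[OF that] y_eq[OF that] by (simp add: algebra_simps)
  have "c + L * ((y K - y (k - 1) - \<phi> k *\<^sub>R e (k - 1)) \<bullet> e (k - 1)) \<le> a k * (v (k - 1) - v K)"
    if "k \<le> K" "0 \<le> k" for k
    using that
  proof (induction k rule: int_le_induct)
    \<comment> \<open>At \<open>k = K\<close> both \<open>d K\<close> and \<open>a K\<close> are 1,
      so the claim is a single prox-grad inequality between y_(K-1) and x_K.\<close>
    case base
    have dK: "d K = 1" using last by (simp add: d_def)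
    have "v K + L * ((x K - y K) \<bullet> (y (K - 1) - x K)) + c \<le> v (K - 1)"
      using ineq[of K "K - 1"] K by (simp add: c_def)
    moreover have "(y K - y (K - 1) - \<phi> K *\<^sub>R e (K - 1)) \<bullet> e (K - 1) = (x K - y K) \<bullet> (y (K - 1) - x K)"
      using x_eq[of K] K dK last by (simp add: algebra_simps)
    ultimately show ?case using dK last by (simp add: a_def)
  next
    case (step i)
    define k where "k = i - 1"
    have k: "0 \<le> k" "k < K" "i = k + 1" using step by (auto simp: k_def)
    have IH: "c + L * ((y K - y k - \<phi> (k + 1) *\<^sub>R e k) \<bullet> e k) \<le> a (k + 1) * (v k - v K)"
      using step k by simp
    have "\<phi> k > 0" using pos[of k] k by simp
    \<comment> \<open>This puts the next weight over the denominator of \<open>a k\<close>; the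
      additive law then follows from
      \<open>2 * \<phi> k = (\<phi> k + \<phi> (k + 1)) + d k\<close>.\<close>
    have a_next: "a (k + 1) = 2 * \<phi> k / (d k)\<^sup>2"
    proof -
      have "d k > 0" "d (k + 1) > 0" using d k by auto
      moreover have "(\<phi> (k + 1) + \<phi> (k + 2)) * (d k)\<^sup>2 = 2 * \<phi> k * (d (k + 1))\<^sup>2"
        using rec[of k] k by (simp add: d_def add.assoc)
      ultimately show ?thesis by (simp add: a_def field_simps)
    qed
    have "c + L * (((y K - y k) + d k *\<^sub>R e k - \<phi> k *\<^sub>R e (k - 1)) \<bullet> e (k - 1))
        \<le> a k * (v (k - 1) - v K)"
    proof (rule fista_g_potential_step)
      show "d k = \<phi> k - \<phi> (k + 1)" by (simp add: d_def)
      show "d k > 0" using d k by simp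
      then show "a k * (d k)\<^sup>2 = \<phi> k + \<phi> (k + 1)" by (simp add: a_def)
      show "a k \<ge> 0" using pos[of k] k by (simp add: a_def)
      have "2 * \<phi> k = (\<phi> k + \<phi> (k + 1)) + d k" by (simp add: d_def)
      then show "a (k + 1) = a k + 1 / d k"
        using \<open>d k > 0\<close> unfolding a_next unfolding a_def
        by (simp add: add_divide_distrib power2_eq_square)
      show "c + L * ((y K - y k - \<phi> (k + 1) *\<^sub>R e k) \<bullet> e k) \<le> a (k + 1) * (v k - v K)"
        by (rule IH)
      have "y (k - 1) - x k = - (d k *\<^sub>R e (k - 1))" using x_eq k by simp
      then show "L * ((d k *\<^sub>R (e (k - 1) - e k)) \<bullet> (- (d k *\<^sub>R e (k - 1))))
          + L / 2 * (norm (d k *\<^sub>R (e (k - 1) - e k)))\<^sup>2 \<le> v (k - 1) - v k"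
        using ineq[of k "k - 1"] g_eq[of k] k by simp
      have "y K - x k = y K - y k + d k *\<^sub>R e k - d k *\<^sub>R e (k - 1)"
        using x_eq[of k] y_eq[of k] k by simp
      moreover have "L * ((x k - y k) \<bullet> (y K - x k)) + L / 2 * (norm (x k - y k))\<^sup>2 \<le> v K - v k"
        using ineq[of k K] k by simp
      ultimately show "L * ((d k *\<^sub>R (e (k - 1) - e k)) \<bullet> (y K - y k + d k *\<^sub>R e k - d k *\<^sub>R e (k - 1)))
          + L / 2 * (norm (d k *\<^sub>R (e (k - 1) - e k)))\<^sup>2 \<le> v K - v k"
        using g_eq[of k] k by (simp only:)
    qed
    moreover have "y K - y (k - 1) = (y K - y k) + d k *\<^sub>R e k"
      using y_eq[of k] k by simp
    ultimately show ?case unfolding k_def[symmetric] by (simp only:)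
  qed
  from this[of 0] K have "c \<le> a 0 * (v (-1) - v K)" by (simp add: e_def)
  then show ?thesis by (simp add: c_def a_def d_def)
qed

section \<open>Bound on the weight at index 0\<close>

text \<open>Reversing the index by \<open>k = K - j\<close> turns the weights and the ratios d_k /
  phi_k into the sequences of \<open>fista_g_rate\<close>; both of its relations are
  \<open>rec\<close> rewritten in fractions.\<close>

lemma fista_g_weight_le:
  fixes \<phi> :: "int \<Rightarrow> real"
  assumes K: "0 \<le> K" and last: "\<phi> (K + 1) = 0" "\<phi> K = 1"
    and pos: "\<And>k. 0 \<le> k \<Longrightarrow> k \<le> K \<Longrightarrow> 0 \<le> \<phi> (k + 1) \<and> \<phi> (k + 1) < \<phi> k"
    and rec: "\<And>k. 0 \<le> k \<Longrightarrow> k < K \<Longrightarrow>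
      (\<phi> (k + 1) + \<phi> (k + 2)) * (\<phi> k - \<phi> (k + 1))\<^sup>2 = 2 * \<phi> k * (\<phi> (k + 1) - \<phi> (k + 2))\<^sup>2"
  shows "(\<phi> 0 + \<phi> 1) / (\<phi> 0 - \<phi> 1)\<^sup>2 \<le> 33 / (real_of_int K + 2)\<^sup>2"
proof -
  define A where "A j = (\<phi> (K - int j) + \<phi> (K - int j + 1)) / (\<phi> (K - int j) - \<phi> (K - int j + 1))\<^sup>2" for j
  define q where "q j = (\<phi> (K - int j) - \<phi> (K - int j + 1)) / \<phi> (K - int j)" for j
  have "A (nat K) \<le> 33 / (real (nat K) + 2)\<^sup>2"
  proof (rule fista_g_rate)
    show "A 0 = 1" "q 0 = 1" using last by (simp_all add: A_def q_def)
    show "0 < q j \<and> q j \<le> 1" if "j \<le> nat K" for j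
    proof -
      have "int j \<le> K" using that K by linarith
      then show ?thesis using pos[of "K - int j"] by (simp add: q_def)
    qed
  next
    fix j assume "j < nat K"
    define k where "k = K - int (Suc j)"
    have k: "0 \<le> k" "k < K" "K - int j = k + 1" "K - int (Suc j) = k"
      using \<open>j < nat K\<close> by (auto simp: k_def)
    obtain p p' p'' where p: "p = \<phi> k" "p' = \<phi> (k + 1)" "p'' = \<phi> (k + 2)" by blast
    have less: "0 \<le> p''" "p'' < p'" "p' < p"
      using pos[of k] pos[of "k + 1"] k by (auto simp: p add.assoc)
    have eq: "(p' + p'') * (p - p')\<^sup>2 = 2 * p * (p' - p'')\<^sup>2"
      using rec[of k] k by (simp add: p)
    have Aj: "A j = (p' + p'') / (p' - p'')\<^sup>2" and qj: "q j = (p' - p'') / p'"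
      unfolding A_def q_def k(3) by (simp_all add: p add.assoc)
    have As: "A (Suc j) = (p + p') / (p - p')\<^sup>2" and qs: "q (Suc j) = (p - p') / p"
      unfolding A_def q_def k(4) by (simp_all add: p)
    have A_eq: "A j = 2 * p / (p - p')\<^sup>2"
      unfolding Aj using eq less by (simp add: frac_eq_eq)
    have "1 - q (Suc j) / 2 = (p + p') / (2 * p)"
      unfolding qs using less by (simp add: field_simps)
    then show "A (Suc j) = A j * (1 - q (Suc j) / 2)"
      unfolding A_eq As using less by simp
    have one_minus: "1 - q j / 2 = (p' + p'') / (2 * p')" "1 - q (Suc j) = p' / p"
      unfolding qj qs using less by (simp_all add: field_simps)
    \<comment> \<open>Over the common denominator \<open>2 * p' * p\<^sup>2\<close> the numerators
      are the two sides of \<open>eq\<close>.\<close>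
    have "(q (Suc j))\<^sup>2 * (1 - q j / 2) = ((p' + p'') * (p - p')\<^sup>2) / (2 * p' * p\<^sup>2)"
      unfolding one_minus qs using less by (simp add: power_divide ac_simps)
    moreover have "(q j)\<^sup>2 * (1 - q (Suc j)) = (2 * p * (p' - p'')\<^sup>2) / (2 * p' * p\<^sup>2)"
      unfolding one_minus qj using less by (simp add: power_divide power2_eq_square)
    ultimately show "(q (Suc j))\<^sup>2 * (1 - q j / 2) = (q j)\<^sup>2 * (1 - q (Suc j))"
      using eq by simp
  qed
  then show ?thesis using K by (simp add: A_def)
qed

section \<open>The two inequalities for FISTA-G\<close>

theorem theorem1:
  fixes L :: real
    and f :: "real ^ 'n \<Rightarrow> real"
    and g F :: "real ^ 'n \<Rightarrow> ereal"
    and F_star :: ereal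
    and K :: int
    and \<phi> :: "int \<Rightarrow> real"
    and x x_plus :: "int \<Rightarrow> real ^ 'n"
  assumes "L > 0"
    and "convex_on UNIV f" and "L_smooth L f"
    and "ext_closed g" and "ext_convex g" and "ext_proper g"
    and "\<And>y. F y = ereal (f y) + g y"
    and "F_star = (INF y. F y)"
    and "K \<ge> 1"
    and "\<phi> (K + 1) = 0" and "\<phi> K = 1"
    and "\<And>k. k \<in> {-1..K - 1} \<Longrightarrow>
           \<phi> k = ((\<phi> (k + 2))\<^sup>2 - \<phi> (k + 1) * \<phi> (k + 2) + 2 * (\<phi> (k + 1))\<^sup>2
                   + (\<phi> (k + 1) - \<phi> (k + 2)) * sqrt ((\<phi> (k + 2))\<^sup>2 + 3 * (\<phi> (k + 1))\<^sup>2))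
                  / (\<phi> (k + 1) + \<phi> (k + 2))"
    and "x_plus (-1) = x 0"
    and "\<And>k. k \<in> {0..K} \<Longrightarrow> x_plus k = prox_grad L f g (x k)"
    and "\<And>k. k \<in> {0..K - 1} \<Longrightarrow>
           x (k + 1) = x_plus k
             + ((\<phi> (k + 1) - \<phi> (k + 2)) / (\<phi> k - \<phi> (k + 1))) *\<^sub>R (x_plus k - x_plus (k - 1))"
  shows "(\<exists>u. is_arg_min (\<lambda>v. (norm v)\<^sup>2) (\<lambda>v. v \<in> subdifferential F (x_plus K)) u \<and>
              (norm u)\<^sup>2 \<le> 4 * (norm (gradient_mapping L f g (x K)))\<^sup>2) \<and>
         ereal (4 * (norm (gradient_mapping L f g (x K)))\<^sup>2)
           \<le> ereal (264 * L / (real_of_int K + 2)\<^sup>2) * (F (x 0) - F_star)"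
proof -
  note L = \<open>L > 0\<close>
  note reg = \<open>L > 0\<close> \<open>convex_on UNIV f\<close> \<open>L_smooth L f\<close> \<open>ext_closed g\<close> \<open>ext_convex g\<close> \<open>ext_proper g\<close>
  note F = \<open>\<And>y. F y = ereal (f y) + g y\<close>
  note K = \<open>K \<ge> 1\<close>
  note \<phi>_last = \<open>\<phi> (K + 1) = 0\<close> \<open>\<phi> K = 1\<close>
  note \<phi>_rec = assms(12)
  note x_plus = assms(14)
  let ?g = "x K - x_plus K"
  let ?G = "gradient_mapping L f g (x K)"
  have G: "?G = L *\<^sub>R ?g"
    using x_plus[of K] K by (simp add: gradient_mapping_def algebra_simps)
  have real: "\<bar>F (x_plus k)\<bar> \<noteq> \<infinity>" if "0 \<le> k" "k \<le> K" for k
    using prox_grad_optimality(1)[OF L reg(4-6)] x_plus[of k] that reg(6)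
    by (auto simp: F ext_proper_def)
  have "\<exists>u. is_arg_min (\<lambda>v. (norm v)\<^sup>2) (\<lambda>v. v \<in> subdifferential F (x_plus K)) u \<and>
      (norm u)\<^sup>2 \<le> 4 * (norm ?G)\<^sup>2"
  proof -
    \<comment> \<open>Smoothness bounds the gradient difference by \<open>norm ?G\<close>, so
      \<open>norm u\<close> is at most twice \<open>norm ?G\<close>; squaring gives the factor
      4.\<close>
    define u where "u = gradient f (x_plus K) - gradient f (x K) + L *\<^sub>R ?g"
    have "u \<in> subdifferential F (x_plus K)"
      using prox_grad_subgradient[OF reg F] x_plus[of K] K by (simp add: u_def)
    then obtain w where w: "is_arg_min (\<lambda>v. (norm v)\<^sup>2) (\<lambda>v. v \<in> subdifferential F (x_plus K)) w"
        "norm w \<le> norm u"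
      using min_norm_subgradient real K by (metis order_refl zero_le_one order_trans)
    have "norm u \<le> norm (gradient f (x_plus K) - gradient f (x K)) + norm (L *\<^sub>R ?g)"
      unfolding u_def by (rule norm_triangle_ineq)
    also have "norm (gradient f (x_plus K) - gradient f (x K)) \<le> norm ?G"
      using reg(3) L unfolding G L_smooth_def by (simp add: norm_minus_commute)
    finally have "norm w \<le> 2 * norm ?G" using w(2) by (simp add: G)
    then have "(norm w)\<^sup>2 \<le> (2 * norm ?G)\<^sup>2" by (intro power_mono) auto
    with w(1) show ?thesis by (auto simp: power_mult_distrib)
  qed
  \<comment> \<open>The bound is proved first with the finite value at \<open>x_plus K\<close>;
    passing to the infimum only enlarges the right side.\<close>
  moreover have "ereal (4 * (norm ?G)\<^sup>2)
      \<le> ereal (264 * L / (real_of_int K + 2)\<^sup>2) * (F (x 0) - F (x_plus K))"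
  proof (cases "F (x 0) = \<infinity>")
    case True
    then show ?thesis using L K real[of K] by (auto simp: ereal_mult_infty)
  next
    case False
    have \<phi>_pos: "0 \<le> \<phi> (k + 1) \<and> \<phi> (k + 1) < \<phi> k" if "0 \<le> k" "k \<le> K" for k
      using that \<phi>_last \<phi>_rec by (intro fista_g_phi[of \<phi> K]) auto
    have \<phi>_sq: "(\<phi> (k + 1) + \<phi> (k + 2)) * (\<phi> k - \<phi> (k + 1))\<^sup>2 = 2 * \<phi> k * (\<phi> (k + 1) - \<phi> (k + 2))\<^sup>2"
      if "0 \<le> k" "k < K" for k
      using \<phi>_pos[of "k + 1"] \<phi>_rec[of k] that
      by (intro fista_g_phi_step(2)) (auto simp: add.assoc)
    \<comment> \<open>With \<open>F (x 0)\<close> finite in this case, all values from index -1 on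
      are real, so the potential argument applies.\<close>
    define v where "v k = real_of_ereal (F (x_plus k))" for k
    have real': "\<bar>F (x_plus k)\<bar> \<noteq> \<infinity>" if "- 1 \<le> k" "k \<le> K" for k
    proof (cases "k = - 1")
      case True
      then show ?thesis
        using False assms(13) reg(6) by (auto simp: F ext_proper_def)
    next
      case False
      then show ?thesis using real that by simp
    qed
    have v: "F (x_plus k) = ereal (v k)" if "- 1 \<le> k" "k \<le> K" for k
      using real'[OF that] by (simp add: v_def ereal_real')
    have ineq: "v k + L * ((x k - x_plus k) \<bullet> (x_plus j - x k)) + L / 2 * (norm (x k - x_plus k))\<^sup>2 \<le> v j"
      if "0 \<le> k" "k \<le> K" "- 1 \<le> j" "j \<le> K" for j k
      using prox_grad_inequality[OF reg F, where x = "x k" and y = "x_plus j"] x_plus[of k] v[of k] v[of j] that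
      by (simp add: add.assoc)
    have potential: "L / 2 * (norm ?g)\<^sup>2 \<le> (\<phi> 0 + \<phi> 1) / (\<phi> 0 - \<phi> 1)\<^sup>2 * (v (-1) - v K)"
      using K \<phi>_last \<phi>_pos \<phi>_sq assms(13,15) ineq
      by (intro fista_g_potential) auto
    also have "\<dots> \<le> 33 / (real_of_int K + 2)\<^sup>2 * (v (-1) - v K)"
    proof (rule mult_right_mono)
      show "(\<phi> 0 + \<phi> 1) / (\<phi> 0 - \<phi> 1)\<^sup>2 \<le> 33 / (real_of_int K + 2)\<^sup>2"
        using K \<phi>_last \<phi>_pos \<phi>_sq by (intro fista_g_weight_le) auto
      \<comment> \<open>The sign of \<open>v (-1) - v K\<close> is read off from
        \<open>potential\<close>: a positive weight times it bounds a square from above.\<close>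
      have "0 < (\<phi> 0 + \<phi> 1) / (\<phi> 0 - \<phi> 1)\<^sup>2" using \<phi>_pos[of 0] K by simp
      moreover have "0 \<le> L / 2 * (norm ?g)\<^sup>2" using L by simp
      ultimately show "0 \<le> v (-1) - v K" using potential
        by (meson order_trans zero_le_mult_iff not_less)
    qed
    \<comment> \<open>The factor \<open>8 * L\<close> turns \<open>L / 2 * (norm ?g)\<^sup>2\<close>
      into \<open>4 * (norm ?G)\<^sup>2\<close> and 33 into \<open>264 * L\<close>.\<close>
    finally have "8 * L * (L / 2 * (norm ?g)\<^sup>2) \<le> 8 * L * (33 / (real_of_int K + 2)\<^sup>2 * (v (-1) - v K))"
      using L by (intro mult_left_mono) auto
    moreover have "8 * L * (L / 2 * (norm ?g)\<^sup>2) = 4 * (norm ?G)\<^sup>2"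
      using L by (simp add: G power_mult_distrib power2_eq_square)
    ultimately have "4 * (norm ?G)\<^sup>2 \<le> 264 * L / (real_of_int K + 2)\<^sup>2 * (v (-1) - v K)"
      by (simp add: ac_simps)
    then show ?thesis using v[of K] v[of "- 1"] K assms(13) by simp
  qed
  moreover have "\<dots> \<le> ereal (264 * L / (real_of_int K + 2)\<^sup>2) * (F (x 0) - F_star)"
  proof (rule ereal_mult_left_mono)
    have "F_star \<le> F (x_plus K)" unfolding \<open>F_star = (INF y. F y)\<close> by (simp add: INF_lower)
    then show "F (x 0) - F (x_plus K) \<le> F (x 0) - F_star" by (intro ereal_minus_mono) auto
    show "0 \<le> ereal (264 * L / (real_of_int K + 2)\<^sup>2)" using L by simp
  qed
  ultimately show ?thesis by (blast intro: order_trans)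
qed

end
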